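(* Let $\mathbb{P}$ be a distribution on $W\times C$ and $\ell$ a surrogate loss function that is $\mathbb{P}$-calibrated. Suppose that: for every fixed $c\in C$, $\ell(d,c)$ is convex in $d\in\mathbb{R}^m$; for every $w\in W$ and $d\in\mathbb{R}^m$, the set $\operatorname{argmin}_{d'\in\mathbb{R}^m}\mathbb{E}[\ell(d',c)\mid w]$ is non-empty and bounded, and $\mathbb{E}[\ell(d,c)\mid w]<\infty$; and $c$ is an integrable random vector, so that $\mathbb{E}[\|c\|_1]<\infty$. Then for all $\epsilon>0$ there exists $\delta>0$ such that, for (measurable) $g:W\to\mathbb{R}^m$, $$R_\ell(g,\mathbb{P})\le R_\ell(\mathbb{P})+\delta \implies R(g,\mathbb{P})\le R(\mathbb{P})+\epsilon .$$
   Context: Setting: $X\subset\mathbb{R}^m$ is a non-empty convex compact set; $f:X\to\mathbb{R}$ is convex and continuous; $W\subseteq\mathbb{R}^k$ and $C\subseteq\mathbb{R}^m$ are given sets. For $d\in\mathbb{R}^m$, $X^*(d):=\operatorname{argmin}_{x\in X}\{f(x)+d^\top x\}$, and $x^*:\mathbb{R}^m\to X$ is a fixed function with $x^*(d)\in X^*(d)$ for all $d$ (any such selection is Lebesgue measurable). The true loss is $L(d,c):=f(x^*(d))+c^\top x^*(d)-\min_{x\in X}\{f(x)+c^\top x\}$. Probability distributions $\mathbb{P}$ on $W\times C$ are defined on the $\sigma$-algebra of Lebesgue measurable sets; measurability is in the sense of Lebesgue; $(w,c)\sim\mathbb{P}$, and $\mathbb{E}[\cdot\mid w]$ is conditional expectation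 given $w$. For measurable $g:W\to\mathbb{R}^m$, the true risk is $R(g,\mathbb{P}):=\mathbb{E}[L(g(w),c)]$ and $R(\mathbb{P}):=\inf\{R(g,\mathbb{P}): g \text{ measurable}\}$. A surrogate loss is a measurable real-valued function $\ell(d,c)$ of $d,c\in\mathbb{R}^m$; its risk is $R_\ell(g,\mathbb{P}):=\mathbb{E}[\ell(g(w),c)]$ and $R_\ell(\mathbb{P}):=\inf\{R_\ell(g,\mathbb{P}): g \text{ measurable}\}$. $\ell$ is $\mathbb{P}$-calibrated if for all $w\in W$ and $\epsilon>0$ there exists $\delta>0$ (which may depend on $w$) such that every $d\in\mathbb{R}^m$ with $\mathbb{E}[\ell(d,c)\mid w]-\min_{d'\in\mathbb{R}^m}\mathbb{E}[\ell(d',c)\mid w]<\delta$ satisfies $\mathbb{E}[L(d,c)\mid w]-\min_{d'\in\mathbb{R}^m}\mathbb{E}[L(d',c)\mid w]<\epsilon$.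
   Formalization: The implication is claimed only for g with finite surrogate risk R_ℓ(g,P) (it fails if R_ℓ(P) is infinite), and g, as well as the infimum R(P), ranges over measurable g with x*(g(w)) measurable, since otherwise R(g,P) may be undefined. *)

theory Defs
  imports "HOL-Probability.Probability"
begin

definition argmin_on :: "('a \<Rightarrow> 'b::ord) \<Rightarrow> 'a set \<Rightarrow> 'a set" where
  "argmin_on h S = {x. is_arg_min h (\<lambda>x. x \<in> S) x}"

definition true_loss ::
  "(real^'m) set \<Rightarrow> (real^'m \<Rightarrow> real) \<Rightarrow> (real^'m \<Rightarrow> real^'m) \<Rightarrow> real^'m \<Rightarrow> real^'m \<Rightarrow> real" where
  "true_loss X f xstar d c = f (xstar d) + c \<bullet> xstar d - (INF x\<in>X. f x + c \<bullet> x)"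

text \<open>
  Expectation with values in the extended reals. It agrees with the Bochner integral on
  integrable functions. It is \<open>\<infinity>\<close> if the expectation is undefined: for a non-measurable
  function by the last clause, and for \<open>\<infinity> - \<infinity>\<close> because this difference is \<open>\<infinity>\<close> for
  type \<^typ>\<open>ereal\<close>. For measurable \<open>h\<close> it is less than \<open>\<infinity>\<close> iff the positive part
  of \<open>h\<close> is integrable.
\<close>

definition ext_expectation :: "'a measure \<Rightarrow> ('a \<Rightarrow> real) \<Rightarrow> ereal" where
  "ext_expectation M h =
    (if h \<in> borel_measurable M
     then enn2ereal (\<integral>\<^sup>+ x. ennreal (h x) \<partial>M) - enn2ereal (\<integral>\<^sup>+ x. ennreal (- h x) \<partial>M)
     else \<infinity>)"

text \<open>
  \<open>\<kappa>\<close> is a version of the regular conditional distribution under \<open>P\<close> of the second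
  component given the first, so \<open>ext_expectation (\<kappa> w) h\<close> is \<open>E[h(c) | w]\<close> for every
  \<open>w\<close>, not just for almost every \<open>w\<close>.
\<close>

definition regular_cond_distribution ::
  "('a \<times> 'b) measure \<Rightarrow> 'a measure \<Rightarrow> 'b measure \<Rightarrow> ('a \<Rightarrow> 'b measure) \<Rightarrow> bool" where
  "regular_cond_distribution P M N \<kappa> \<longleftrightarrow>
    \<kappa> \<in> M \<rightarrow>\<^sub>M prob_algebra N \<and>
    (\<forall>A\<in>sets M. \<forall>B\<in>sets N.
      emeasure P (A \<times> B) = (\<integral>\<^sup>+ w\<in>A. emeasure (\<kappa> w) B \<partial>distr P M fst))"

definition risk ::
  "('a \<times> 'b) measure \<Rightarrow> ('d \<Rightarrow> 'b \<Rightarrow> real) \<Rightarrow> ('a \<Rightarrow> 'd) \<Rightarrow> ereal" where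
  "risk P loss g = ext_expectation P (\<lambda>(w, c). loss (g w) c)"

definition decision_rules :: "(real^'k) set \<Rightarrow> (real^'k \<Rightarrow> real^'m) set" where
  "decision_rules W = lebesgue_on W \<rightarrow>\<^sub>M borel"

text \<open>
  A Lebesgue measurable selection \<open>xstar\<close> composed with a measurable \<open>g\<close> can fail to be
  measurable, because \<open>g\<close> may take values in a null set on which \<open>xstar\<close> is arbitrary.
  The true risk of \<open>g\<close> is then undefined. The following rules exclude exactly this; if
  \<open>xstar\<close> is Borel measurable they are all the decision rules.
\<close>

definition evaluable_rules ::
  "(real^'k) set \<Rightarrow> (real^'m \<Rightarrow> real^'m) \<Rightarrow> (real^'k \<Rightarrow> real^'m) set" where
  "evaluable_rules W xstar =
    {g \<in> decision_rules W. (\<lambda>w. xstar (g w)) \<in> borel_measurable (lebesgue_on W)}"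

definition optimal_risk ::
  "('a \<Rightarrow> 'd) set \<Rightarrow> ('a \<times> 'b) measure \<Rightarrow> ('d \<Rightarrow> 'b \<Rightarrow> real) \<Rightarrow> ereal" where
  "optimal_risk G P loss = (INF g\<in>G. risk P loss g)"

text \<open>
  \<open>P\<close>-calibration of the surrogate loss \<open>l\<close> for the true loss \<open>L\<close>; it depends on \<open>P\<close>
  only through \<open>\<kappa>\<close>. If a conditional expectation of \<open>L\<close> is infinite, then the excess
  \<open>\<infinity> - \<infinity> = \<infinity>\<close> is not less than \<open>\<epsilon>\<close>.
\<close>

definition calibrated ::
  "'a set \<Rightarrow> ('a \<Rightarrow> 'b measure) \<Rightarrow> ('d \<Rightarrow> 'b \<Rightarrow> real) \<Rightarrow> ('d \<Rightarrow> 'b \<Rightarrow> real) \<Rightarrow> bool" where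
  "calibrated W \<kappa> L l \<longleftrightarrow>
    (\<forall>w\<in>W. \<forall>\<epsilon>::real. \<epsilon> > 0 \<longrightarrow> (\<exists>\<delta>::real. \<delta> > 0 \<and> (\<forall>d.
      ext_expectation (\<kappa> w) (l d) - (INF d'. ext_expectation (\<kappa> w) (l d')) < ereal \<delta> \<longrightarrow>
      ext_expectation (\<kappa> w) (L d) - (INF d'. ext_expectation (\<kappa> w) (L d')) < ereal \<epsilon>)))"

end

(*
  Along decision rules whose surrogate risk tends to the optimum, the conditional surrogate excess
  tends to 0 in L1, because near-minimizers of the conditional surrogate risk can be chosen
  measurably. If the excesses are summable, the conditional excess tends to 0 almost surely, so
  calibration, whose delta may depend on w without any measurability, can be applied for each w
  separately: the conditional regret of the true loss tends to 0 almost surely. This regret is the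
  true loss at the conditional mean of c, which is at most a constant times 1 + |E[c | w]|
  since X is compact, and dominated convergence concludes.
*)
theory Submission
  imports Defs
begin

section \<open>Disintegration along a regular conditional distribution\<close>

text \<open>The true loss \<open>f (xstar d) + c \<bullet> xstar d - opt_value c\<close> is affine
  in \<open>c\<close> up to a term free of \<open>d\<close>. Averaging over \<open>c\<close> thus
  gives the loss at the mean plus a constant; this is the reason for the closed form of the
  conditional regret. The obstacles are measurability and finiteness. \<open>P\<close> lives on the
  Lebesgue sets of \<open>W \<times> C\<close>, which may exceed the product of the two
  \<sigma>-algebras, and a jointly Lebesgue measurable loss need not stay measurable when a rule
  \<open>g\<close> is inserted. Convexity of \<open>l\<close> in \<open>d\<close> repairs this: it
  gives continuity, so that sections, compositions and infima reduce to countably many decisions.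
  Boundedness of the sets of minimizers excludes conditional surrogate risks equal to
  \<open>-\<infinity>\<close>. The \<delta> of the theorem is not computed from those of
  calibration: failure for every \<delta> = 2^-n yields a single sequence of rules to which the
  almost sure argument applies.\<close>

locale disintegration = prob_space P
  for P :: "('a \<times> 'b) measure" and M :: "'a measure" and N :: "'b measure"
    and \<kappa> :: "'a \<Rightarrow> 'b measure" +
  assumes space_P: "space P = space M \<times> space N"
    and fst_P [measurable]: "fst \<in> P \<rightarrow>\<^sub>M M"
    and snd_P [measurable]: "snd \<in> P \<rightarrow>\<^sub>M N"
    and cond_dist: "regular_cond_distribution P M N \<kappa>"
begin

definition \<mu> :: "'a measure" where "\<mu> = distr P M fst"

lemma space_\<mu> [simp]: "space \<mu> = space M"
  and sets_\<mu> [simp, measurable_cong]: "sets \<mu> = sets M"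
  by (simp_all add: \<mu>_def)

lemma prob_space_\<mu>: "prob_space \<mu>"
  unfolding \<mu>_def by (rule prob_space_distr) simp

lemma kernel_prob [measurable]: "\<kappa> \<in> M \<rightarrow>\<^sub>M prob_algebra N"
  using cond_dist by (simp add: regular_cond_distribution_def)

lemma kernel_subprob [measurable]: "\<kappa> \<in> M \<rightarrow>\<^sub>M subprob_algebra N"
  by (rule measurable_prob_algebraD[OF kernel_prob])

lemma prob_space_kernel: "w \<in> space M \<Longrightarrow> prob_space (\<kappa> w)"
  using measurable_space[OF kernel_prob] by (auto simp: space_prob_algebra)

lemma sets_kernel: "w \<in> space M \<Longrightarrow> sets (\<kappa> w) = sets N"
  using measurable_space[OF kernel_prob] by (auto simp: space_prob_algebra)

lemma space_kernel: "w \<in> space M \<Longrightarrow> space (\<kappa> w) = space N"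
  by (rule sets_eq_imp_space_eq[OF sets_kernel])

lemma measurable_kernel: "w \<in> space M \<Longrightarrow> u \<in> N \<rightarrow>\<^sub>M K \<Longrightarrow> u \<in> \<kappa> w \<rightarrow>\<^sub>M K"
  using measurable_cong_sets[OF sets_kernel refl] by blast

text \<open>Pairing the two projections gives the identity, so the \<sigma>-algebra of
  \<open>P\<close> contains the product one.\<close>

lemma measurable_P: "u \<in> M \<Otimes>\<^sub>M N \<rightarrow>\<^sub>M K \<Longrightarrow> u \<in> P \<rightarrow>\<^sub>M K"
  using measurable_compose[OF measurable_Pair[OF fst_P snd_P], of u K] by simp

lemma space_M_nonempty: "space M \<noteq> {}"
  using not_empty space_P by auto

lemma rectangle:
  assumes "A \<in> sets M" "B \<in> sets N"
  shows "emeasure P (A \<times> B) = (\<integral>\<^sup>+ w. emeasure (\<kappa> w) B * indicator A w \<partial>\<mu>)"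
  using cond_dist assms by (simp add: regular_cond_distribution_def \<mu>_def)

text \<open>
  \<open>P\<close> may live on a \<open>\<sigma>\<close>-algebra larger than the product one (here: the Lebesgue sets of the
  product); the kernel determines only its restriction to the product \<open>\<sigma>\<close>-algebra.
\<close>

lemma distr_P_eq_bind:
  "distr P (M \<Otimes>\<^sub>M N) (\<lambda>x. x) = \<mu> \<bind> (\<lambda>w. distr (\<kappa> w) (M \<Otimes>\<^sub>M N) (Pair w))"
proof -
  let ?K = "\<lambda>w. distr (\<kappa> w) (M \<Otimes>\<^sub>M N) (Pair w)"
  let ?E = "{A \<times> B | A B. A \<in> sets M \<and> B \<in> sets N}"
  have K: "?K \<in> \<mu> \<rightarrow>\<^sub>M subprob_algebra (M \<Otimes>\<^sub>M N)"
    by (rule measurable_distr2) measurable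
  have id: "(\<lambda>x. x) \<in> P \<rightarrow>\<^sub>M M \<Otimes>\<^sub>M N"
    by (rule measurable_P) simp
  show ?thesis
  proof (rule measure_eqI_generator_eq[where \<Omega>="space M \<times> space N" and E="?E"
        and A="\<lambda>_. space M \<times> space N"])
    show "Int_stable ?E" by (rule Int_stable_pair_measure_generator)
    show "?E \<subseteq> Pow (space M \<times> space N)" by (rule pair_measure_closed)
    show "sets (distr P (M \<Otimes>\<^sub>M N) (\<lambda>x. x)) = sigma_sets (space M \<times> space N) ?E"
      by (simp add: sets_pair_measure)
    show "sets (\<mu> \<bind> ?K) = sigma_sets (space M \<times> space N) ?E"
      by (subst sets_bind[where N="M \<Otimes>\<^sub>M N"]) (auto simp: space_M_nonempty sets_pair_measure)
    fix Z assume "Z \<in> ?E"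
    then obtain A B where Z: "Z = A \<times> B" and A [measurable]: "A \<in> sets M"
      and B [measurable]: "B \<in> sets N" by auto
    have "emeasure (\<mu> \<bind> ?K) Z = (\<integral>\<^sup>+ w. emeasure (?K w) Z \<partial>\<mu>)"
      by (rule emeasure_bind[OF _ K]) (auto simp: space_M_nonempty Z)
    also have "\<dots> = (\<integral>\<^sup>+ w. emeasure (\<kappa> w) B * indicator A w \<partial>\<mu>)"
    proof (rule nn_integral_cong)
      fix w assume "w \<in> space \<mu>"
      then have w: "w \<in> space M" by simp
      have "Pair w \<in> N \<rightarrow>\<^sub>M M \<Otimes>\<^sub>M N" using w by measurable
      from measurable_kernel[OF w this]
      have "emeasure (?K w) Z = emeasure (\<kappa> w) (Pair w -` Z \<inter> space (\<kappa> w))"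
        by (rule emeasure_distr) (simp add: Z)
      also have "Pair w -` Z \<inter> space (\<kappa> w) = (if w \<in> A then B else {})"
        using sets.sets_into_space[OF B] by (auto simp: Z space_kernel[OF w])
      finally show "emeasure (?K w) Z = emeasure (\<kappa> w) B * indicator A w" by simp
    qed
    also have "\<dots> = emeasure P Z" by (simp add: Z rectangle)
    finally show "emeasure (distr P (M \<Otimes>\<^sub>M N) (\<lambda>x. x)) Z = emeasure (\<mu> \<bind> ?K) Z"
      using Sigma_mono[OF sets.sets_into_space[OF A] sets.sets_into_space[OF B]]
      by (subst emeasure_distr[OF id]) (simp_all add: Z space_P Int_absorb2)
  next
    show "range (\<lambda>_::nat. space M \<times> space N) \<subseteq> ?E" by auto
    show "emeasure (distr P (M \<Otimes>\<^sub>M N) (\<lambda>x. x)) (space M \<times> space N) \<noteq> \<infinity>" for i :: nat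
      by (subst emeasure_distr[OF id]) (auto simp: space_P[symmetric] space_pair_measure[symmetric])
    show "(\<Union>i::nat. space M \<times> space N) = space M \<times> space N" by simp
  qed
qed

text \<open>A product-measurable integrand sees only the restriction of \<open>P\<close> to the
  product \<sigma>-algebra. This restriction is a Giry bind, and integrals over a bind are iterated
  integrals.\<close>

lemma nn_integral_disintegrate:
  assumes [measurable]: "u \<in> borel_measurable (M \<Otimes>\<^sub>M N)"
  shows "(\<integral>\<^sup>+ x. u x \<partial>P) = (\<integral>\<^sup>+ w. \<integral>\<^sup>+ c. u (w, c) \<partial>\<kappa> w \<partial>\<mu>)"
proof -
  have "(\<integral>\<^sup>+ x. u x \<partial>P) = (\<integral>\<^sup>+ x. u x \<partial>distr P (M \<Otimes>\<^sub>M N) (\<lambda>x. x))"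
    by (subst nn_integral_distr) (auto intro: measurable_P)
  also have "\<dots> = (\<integral>\<^sup>+ w. \<integral>\<^sup>+ y. u y \<partial>distr (\<kappa> w) (M \<Otimes>\<^sub>M N) (Pair w) \<partial>\<mu>)"
    unfolding distr_P_eq_bind
    by (rule nn_integral_bind[OF assms], rule measurable_distr2) measurable
  also have "\<dots> = (\<integral>\<^sup>+ w. \<integral>\<^sup>+ c. u (w, c) \<partial>\<kappa> w \<partial>\<mu>)"
  proof (rule nn_integral_cong)
    fix w assume "w \<in> space \<mu>"
    then have w: "w \<in> space M" by simp
    have "Pair w \<in> N \<rightarrow>\<^sub>M M \<Otimes>\<^sub>M N" using w by measurable
    then show "(\<integral>\<^sup>+ y. u y \<partial>distr (\<kappa> w) (M \<Otimes>\<^sub>M N) (Pair w)) = (\<integral>\<^sup>+ c. u (w, c) \<partial>\<kappa> w)"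
      by (intro nn_integral_distr measurable_kernel[OF w]) auto
  qed
  finally show ?thesis .
qed

text \<open>The integrand varies with \<open>w\<close>, whereas integration is measurable in the
  measure for a fixed integrand. Pushing \<open>\<kappa> w\<close> forward along
  \<open>Pair w\<close> moves the dependence on \<open>w\<close> into the measure.\<close>

lemma borel_measurable_kernel_integral:
  fixes u :: "'a \<times> 'b \<Rightarrow> 'c::{banach, second_countable_topology}"
  assumes [measurable]: "u \<in> borel_measurable (M \<Otimes>\<^sub>M N)"
  shows "(\<lambda>w. \<integral>c. u (w, c) \<partial>\<kappa> w) \<in> borel_measurable M"
proof -
  note integral_measurable_subprob_algebra[measurable] measurable_distr2[measurable]
  have "(\<lambda>w. integral\<^sup>L (distr (\<kappa> w) (M \<Otimes>\<^sub>M N) (Pair w)) u) \<in> borel_measurable M"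
    by measurable
  then show ?thesis
    by (rule measurable_cong[THEN iffD1, rotated])
      (rule integral_distr, auto intro: measurable_kernel)
qed

text \<open>Fubini for the kernel, from Tonelli for the positive and the negative part.
  Integrability under \<open>\<kappa> w\<close> is obtained almost surely; wherever it fails, the
  Bochner integral is 0 by convention.\<close>

lemma integral_disintegrate:
  fixes u :: "'a \<times> 'b \<Rightarrow> real"
  assumes [measurable]: "u \<in> borel_measurable (M \<Otimes>\<^sub>M N)" and "integrable P u"
  shows AE_integrable_kernel: "AE w in \<mu>. integrable (\<kappa> w) (\<lambda>c. u (w, c))"
    and integrable_kernel_integral: "integrable \<mu> (\<lambda>w. \<integral>c. u (w, c) \<partial>\<kappa> w)"
    and integral_kernel_integral: "(\<integral>x. u x \<partial>P) = (\<integral>w. \<integral>c. u (w, c) \<partial>\<kappa> w \<partial>\<mu>)"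
proof -
  have sec: "(\<lambda>c. u (w, c)) \<in> borel_measurable (\<kappa> w)" if w: "w \<in> space M" for w
    by (rule measurable_kernel[OF w]) (use w in measurable)
  have kn: "(\<lambda>w. \<integral>\<^sup>+ c. ennreal (v (u (w, c))) \<partial>\<kappa> w) \<in> borel_measurable M"
    if [measurable]: "v \<in> borel_measurable borel" for v :: "real \<Rightarrow> real"
    by (rule nn_integral_measurable_subprob_algebra2[OF _ kernel_subprob]) measurable
  have [measurable]: "(\<lambda>w. \<integral>\<^sup>+ c. ennreal (u (w, c)) \<partial>\<kappa> w) \<in> borel_measurable M"
    "(\<lambda>w. \<integral>\<^sup>+ c. ennreal \<bar>u (w, c)\<bar> \<partial>\<kappa> w) \<in> borel_measurable M"
    "(\<lambda>w. \<integral>\<^sup>+ c. ennreal (- u (w, c)) \<partial>\<kappa> w) \<in> borel_measurable M"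
    using kn[of "\<lambda>x. x"] kn[of abs] kn[of uminus] by simp_all
  have [measurable]: "(\<lambda>w. \<integral>c. u (w, c) \<partial>\<kappa> w) \<in> borel_measurable M"
    by (rule borel_measurable_kernel_integral[OF assms(1)])
  have fin: "(\<integral>\<^sup>+ w. \<integral>\<^sup>+ c. ennreal \<bar>u (w, c)\<bar> \<partial>\<kappa> w \<partial>\<mu>) < \<infinity>"
    using assms(2) by (subst nn_integral_disintegrate[symmetric]) (auto simp: integrable_iff_bounded)
  have "AE w in \<mu>. (\<integral>\<^sup>+ c. ennreal \<bar>u (w, c)\<bar> \<partial>\<kappa> w) \<noteq> \<infinity>"
    using fin by (intro nn_integral_PInf_AE) auto
  then show ae: "AE w in \<mu>. integrable (\<kappa> w) (\<lambda>c. u (w, c))"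
    by (rule AE_mp, intro AE_I2 impI) (auto simp: integrable_iff_bounded sec less_top)
  show int: "integrable \<mu> (\<lambda>w. \<integral>c. u (w, c) \<partial>\<kappa> w)"
  proof (rule integrableI_bounded)
    have "(\<integral>\<^sup>+ w. ennreal (norm (\<integral>c. u (w, c) \<partial>\<kappa> w)) \<partial>\<mu>)
        \<le> (\<integral>\<^sup>+ w. \<integral>\<^sup>+ c. ennreal \<bar>u (w, c)\<bar> \<partial>\<kappa> w \<partial>\<mu>)"
      by (rule nn_integral_mono_AE, use ae in eventually_elim)
        (drule integral_norm_bound_ennreal, simp)
    with fin show "(\<integral>\<^sup>+ w. ennreal (norm (\<integral>c. u (w, c) \<partial>\<kappa> w)) \<partial>\<mu>) < \<infinity>"
      by (rule le_less_trans[rotated])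
  qed simp
  \<comment> \<open>\<open>ennreal\<close> truncates negative reals to 0, so taking the identity or
    negation for \<open>v\<close> gives the positive or the negative part. \<open>enn2real\<close>
    sends \<infinity>, a value met on a null set only, to 0.\<close>
  have part: "(\<integral>\<^sup>+ x. ennreal (v (u x)) \<partial>P) = ennreal (\<integral>w. enn2real (\<integral>\<^sup>+ c. ennreal (v (u (w, c))) \<partial>\<kappa> w) \<partial>\<mu>)
      \<and> integrable \<mu> (\<lambda>w. enn2real (\<integral>\<^sup>+ c. ennreal (v (u (w, c))) \<partial>\<kappa> w))"
    if [measurable]: "v \<in> borel_measurable borel" and le: "\<And>x. v x \<le> \<bar>x\<bar>" for v :: "real \<Rightarrow> real"
  proof -
    let ?f = "\<lambda>w. \<integral>\<^sup>+ c. ennreal (v (u (w, c))) \<partial>\<kappa> w"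
    have m [measurable]: "?f \<in> borel_measurable M"
      by (rule nn_integral_measurable_subprob_algebra2[OF _ kernel_subprob]) measurable
    have "(\<integral>\<^sup>+ w. ?f w \<partial>\<mu>) \<le> (\<integral>\<^sup>+ w. \<integral>\<^sup>+ c. ennreal \<bar>u (w, c)\<bar> \<partial>\<kappa> w \<partial>\<mu>)"
      by (intro nn_integral_mono ennreal_leI le)
    with fin have f: "(\<integral>\<^sup>+ w. ?f w \<partial>\<mu>) < \<infinity>" by (rule le_less_trans[rotated])
    then have "AE w in \<mu>. ?f w \<noteq> \<infinity>" by (intro nn_integral_PInf_AE) auto
    then have eq: "(\<integral>\<^sup>+ w. ennreal (enn2real (?f w)) \<partial>\<mu>) = (\<integral>\<^sup>+ w. ?f w \<partial>\<mu>)"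
      by (intro nn_integral_cong_AE, elim AE_mp) (auto simp: less_top)
    have i: "integrable \<mu> (\<lambda>w. enn2real (?f w))"
      by (rule integrableI_bounded) (use f eq in auto)
    show ?thesis
      using i by (simp add: nn_integral_eq_integral[symmetric] eq nn_integral_disintegrate)
  qed
  have "(\<integral>x. u x \<partial>P) = enn2real (\<integral>\<^sup>+x. ennreal (u x) \<partial>P) - enn2real (\<integral>\<^sup>+x. ennreal (- u x) \<partial>P)"
    by (rule real_lebesgue_integral_def[OF assms(2)])
  also have "\<dots> = (\<integral>w. enn2real (\<integral>\<^sup>+ c. ennreal (u (w, c)) \<partial>\<kappa> w) \<partial>\<mu>) -
      (\<integral>w. enn2real (\<integral>\<^sup>+ c. ennreal (- u (w, c)) \<partial>\<kappa> w) \<partial>\<mu>)"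
    using part[of "\<lambda>x. x"] part[of uminus] by simp
  also have "\<dots> = (\<integral>w. enn2real (\<integral>\<^sup>+ c. ennreal (u (w, c)) \<partial>\<kappa> w) -
      enn2real (\<integral>\<^sup>+ c. ennreal (- u (w, c)) \<partial>\<kappa> w) \<partial>\<mu>)"
    using part[of "\<lambda>x. x"] part[of uminus] by (intro Bochner_Integration.integral_diff[symmetric]) auto
  also have "\<dots> = (\<integral>w. \<integral>c. u (w, c) \<partial>\<kappa> w \<partial>\<mu>)"
    by (rule integral_cong_AE, measurable, use ae in eventually_elim)
      (simp add: real_lebesgue_integral_def)
  finally show "(\<integral>x. u x \<partial>P) = (\<integral>w. \<integral>c. u (w, c) \<partial>\<kappa> w \<partial>\<mu>)" .
qed

end

section \<open>Extended expectations of convex losses\<close>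

lemma ext_expectation_eq_integral:
  assumes "integrable M h"
  shows "ext_expectation M h = ereal (\<integral>x. h x \<partial>M)"
proof -
  have "(\<integral>\<^sup>+x. ennreal (v x) \<partial>M) < \<infinity>" if "\<And>x. v x \<le> \<bar>h x\<bar>" for v
    using assms that
    by (auto simp: integrable_iff_bounded elim!: order.strict_trans1[rotated]
        intro!: nn_integral_mono ennreal_leI)
  from this[of h] this[of "\<lambda>x. - h x"]
  have f: "(\<integral>\<^sup>+x. ennreal (h x) \<partial>M) < \<infinity>" "(\<integral>\<^sup>+x. ennreal (- h x) \<partial>M) < \<infinity>"
    by auto
  have e: "enn2ereal a = ereal (enn2real a)" if "a < \<infinity>" for a
    using that by (cases a) (auto simp: ennreal.rep_eq)
  show ?thesis
    using assms f e by (simp add: ext_expectation_def real_lebesgue_integral_def[OF assms])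
qed

lemma ext_expectation_less_PInf:
  "ext_expectation M h < \<infinity> \<longleftrightarrow> h \<in> borel_measurable M \<and> (\<integral>\<^sup>+x. ennreal (h x) \<partial>M) < \<infinity>"
proof (cases "h \<in> borel_measurable M")
  case True
  then show ?thesis
    by (cases "\<integral>\<^sup>+x. ennreal (h x) \<partial>M"; cases "\<integral>\<^sup>+x. ennreal (- h x) \<partial>M")
      (auto simp: ext_expectation_def ennreal.rep_eq)
qed (simp add: ext_expectation_def)

lemma integrable_if_nn_integral_parts:
  fixes h :: "'a \<Rightarrow> real"
  assumes [measurable]: "h \<in> borel_measurable M"
    and "(\<integral>\<^sup>+x. ennreal (h x) \<partial>M) < \<infinity>" "(\<integral>\<^sup>+x. ennreal (- h x) \<partial>M) < \<infinity>"
  shows "integrable M h"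
proof (rule integrableI_bounded)
  have "(\<integral>\<^sup>+x. ennreal (norm (h x)) \<partial>M) = (\<integral>\<^sup>+x. ennreal (h x) + ennreal (- h x) \<partial>M)"
    by (rule nn_integral_cong) (simp add: abs_if ennreal_neg)
  also have "\<dots> < \<infinity>"
    using assms by (subst nn_integral_add) auto
  finally show "(\<integral>\<^sup>+x. ennreal (norm (h x)) \<partial>M) < \<infinity>" .
qed simp

text \<open>Once the positive part has a finite integral, only the negative part can destroy
  integrability.\<close>

lemma ext_expectation_eq_MInf:
  assumes "ext_expectation M h < \<infinity>" "\<not> integrable M h"
  shows "ext_expectation M h = - \<infinity>"
proof -
  have h: "h \<in> borel_measurable M" "(\<integral>\<^sup>+x. ennreal (h x) \<partial>M) < \<infinity>"
    using assms(1) unfolding ext_expectation_less_PInf by simp_all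
  with assms(2) have "(\<integral>\<^sup>+x. ennreal (- h x) \<partial>M) = \<infinity>"
    using integrable_if_nn_integral_parts[OF h] by (metis infinity_ennreal_def less_top)
  with h show ?thesis
    by (cases "\<integral>\<^sup>+x. ennreal (h x) \<partial>M") (auto simp: ext_expectation_def ennreal.rep_eq)
qed

lemma integrable_if_ext_expectation_finite:
  assumes "\<bar>ext_expectation M h\<bar> \<noteq> \<infinity>"
  shows "integrable M h"
  using assms ext_expectation_eq_MInf[of M h] by (cases "ext_expectation M h") auto

text \<open>
  If \<open>l d\<^sub>0\<close> has expectation \<open>- \<infinity>\<close>, then by convexity on the segment from \<open>d\<^sub>0\<close> to \<open>2 x - d\<^sub>0\<close>
  so has \<open>l x\<close> for every \<open>x\<close>, and the set of minimizers is the whole space.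
\<close>

lemma integrable_convex_loss:
  fixes l :: "'d::euclidean_space \<Rightarrow> 'c \<Rightarrow> real"
  assumes conv: "\<And>c. c \<in> space M \<Longrightarrow> convex_on UNIV (\<lambda>d. l d c)"
    and fin: "\<And>d. ext_expectation M (l d) < \<infinity>"
    and bdd: "bounded (argmin_on (\<lambda>d. ext_expectation M (l d)) UNIV)"
  shows "integrable M (l d)"
proof (rule ccontr)
  assume neg: "\<not> integrable M (l d)"
  have [measurable]: "l x \<in> borel_measurable M" for x
    using fin[of x] unfolding ext_expectation_less_PInf by simp
  have pos: "(\<integral>\<^sup>+c. ennreal (l x c) \<partial>M) < \<infinity>" for x
    using fin[of x] unfolding ext_expectation_less_PInf by simp
  have "ext_expectation M (l x) = - \<infinity>" for x
  proof (rule ext_expectation_eq_MInf[OF fin], rule notI)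
    assume int: "integrable M (l x)"
    have mid: "2 * l x c \<le> l d c + l (2 *\<^sub>R x - d) c" if "c \<in> space M" for c
    proof -
      have "l ((1 - 1 / 2) *\<^sub>R d + (1 / 2) *\<^sub>R (2 *\<^sub>R x - d)) c
          \<le> (1 - 1 / 2) * l d c + (1 / 2) * l (2 *\<^sub>R x - d) c"
        by (rule convex_onD[OF conv[OF that]]) auto
      moreover have "(1 - 1 / 2) *\<^sub>R d + (1 / 2) *\<^sub>R (2 *\<^sub>R x - d) = x"
        by (simp add: scaleR_right_diff_distrib)
      ultimately show ?thesis by simp
    qed
    \<comment> \<open>Solved for \<open>- l d c\<close>, the midpoint inequality bounds the negative
      part of \<open>l d\<close> by \<open>2 * \<bar>l x c\<bar>\<close> plus the positive part of
      the loss at the reflected point, both of finite integral.\<close>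
    have "(\<integral>\<^sup>+c. ennreal (- l d c) \<partial>M)
        \<le> (\<integral>\<^sup>+c. ennreal (2 * \<bar>l x c\<bar>) + ennreal (l (2 *\<^sub>R x - d) c) \<partial>M)"
    proof (rule nn_integral_mono)
      fix c assume "c \<in> space M"
      then have "- l d c \<le> 2 * \<bar>l x c\<bar> + max 0 (l (2 *\<^sub>R x - d) c)"
        using mid[of c] by linarith
      then have "ennreal (- l d c) \<le> ennreal (2 * \<bar>l x c\<bar> + max 0 (l (2 *\<^sub>R x - d) c))"
        by (rule ennreal_leI)
      then show "ennreal (- l d c) \<le> ennreal (2 * \<bar>l x c\<bar>) + ennreal (l (2 *\<^sub>R x - d) c)"
        by (subst (asm) ennreal_plus) (auto simp: max_def ennreal_neg split: if_splits)
    qed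
    also have "\<dots> = (\<integral>\<^sup>+c. ennreal (norm (2 * l x c)) \<partial>M) + (\<integral>\<^sup>+c. ennreal (l (2 *\<^sub>R x - d) c) \<partial>M)"
      by (subst nn_integral_add) (auto simp: abs_mult)
    also have "\<dots> < \<infinity>"
      using pos[of "2 *\<^sub>R x - d"] integrable_mult_right[OF int, of 2]
      unfolding integrable_iff_bounded by simp
    finally have "integrable M (l d)"
      by (intro integrable_if_nn_integral_parts pos) measurable
    with neg show False by contradiction
  qed
  then have "argmin_on (\<lambda>d. ext_expectation M (l d)) UNIV = UNIV"
    by (auto simp: argmin_on_def is_arg_min_def)
  with bdd show False by simp
qed

text \<open>Sections of the Borel version \<open>l'\<close> are Borel. By Fubini for the exceptional
  null set, almost every section of \<open>l\<close> agrees almost everywhere with that of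
  \<open>l'\<close>, and completeness of Lebesgue measure absorbs the difference.\<close>

lemma AE_lebesgue_measurable_section:
  fixes l :: "'a::euclidean_space \<Rightarrow> 'b::euclidean_space \<Rightarrow> real"
  assumes "(\<lambda>(d, c). l d c) \<in> borel_measurable lebesgue"
  shows "AE d in lborel. l d \<in> borel_measurable lebesgue"
proof -
  obtain l' where l' [measurable]: "l' \<in> borel_measurable lborel"
    and eq: "AE x in lborel. (case x of (d, c) \<Rightarrow> l d c) = l' x"
    using completion_ex_borel_measurable_real[OF assms] by blast
  have "AE d in lborel. AE c in lborel. l d c = l' (d, c)"
    using lborel_pair.AE_pair[OF eq[unfolded lborel_prod[symmetric]]] by simp
  then show ?thesis
  proof eventually_elim
    case (elim d)
    have "(\<lambda>c. l' (d, c)) \<in> borel_measurable lborel" by measurable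
    then have m: "(\<lambda>c. l' (d, c)) \<in> borel_measurable lebesgue" by (rule measurable_completion)
    show ?case
    proof (rule measurableI)
      fix A :: "real set" assume A: "A \<in> sets borel"
      have "AE c in lebesgue. (c \<in> (\<lambda>c. l' (d, c)) -` A \<inter> space lebesgue) = (c \<in> l d -` A \<inter> space lebesgue)"
        by (rule AE_completion, use elim in eventually_elim) auto
      then show "l d -` A \<inter> space lebesgue \<in> sets lebesgue"
        using measurable_sets[OF m A] by (subst completion.in_sets_AE) auto
    qed simp
  qed
qed

text \<open>
  Fubini yields measurable sections for almost every \<open>d\<close> only. Such \<open>d\<close> are dense, and continuity
  in \<open>d\<close> extends measurability to all sections.
\<close>

lemma measurable_convex_section:
  fixes l :: "'a::euclidean_space \<Rightarrow> 'b::euclidean_space \<Rightarrow> real"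
  assumes meas: "(\<lambda>(d, c). l d c) \<in> borel_measurable lebesgue"
    and conv: "\<And>c. c \<in> C \<Longrightarrow> convex_on UNIV (\<lambda>d. l d c)"
  shows "l d \<in> borel_measurable (lebesgue_on C)"
proof -
  \<comment> \<open>A ball free of good points would be a null set, which no non-empty open set
    is.\<close>
  have "\<exists>x. dist x d < 1 / Suc n \<and> l x \<in> borel_measurable lebesgue" for n
  proof (rule ccontr)
    assume "\<not> ?thesis"
    with AE_lebesgue_measurable_section[OF meas]
    have "AE x in lborel. x \<notin> ball d (1 / Suc n)"
      by (elim AE_mp) (auto simp: dist_commute)
    then have "emeasure lborel (ball d (1 / Suc n)) = 0"
      by (subst (asm) AE_iff_measurable[OF _ refl]) (auto simp: ball_def)
    then have "emeasure lebesgue (ball d (1 / Suc n)) = 0" by simp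
    moreover have "open (ball d (1 / Suc n))" "ball d (1 / Suc n) \<noteq> {}" by auto
    ultimately show False
      using open_not_negligible[of "ball d (1 / Suc n)"]
      by (auto simp: negligible_iff_null_sets null_sets_def)
  qed
  then obtain x where x: "\<And>n. dist (x n) d < 1 / Suc n" "\<And>n. l (x n) \<in> borel_measurable lebesgue"
    by metis
  have "x \<longlonglongrightarrow> d"
    using x(1) by (intro metric_tendsto_imp_tendsto[OF LIMSEQ_inverse_real_of_nat])
      (auto intro!: always_eventually less_imp_le simp: inverse_eq_divide)
  \<comment> \<open>The restriction to \<open>C\<close> matters here: convexity, and with it
    continuity in \<open>d\<close>, is available for \<open>c \<in> C\<close> only.\<close>
  show ?thesis
  proof (rule borel_measurable_LIMSEQ_metric)
    show "l (x n) \<in> borel_measurable (lebesgue_on C)" for n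
      by (rule measurable_restrict_space1[OF x(2)])
    fix c assume "c \<in> space (lebesgue_on C)"
    then have "continuous_on UNIV (\<lambda>d. l d c)"
      using conv by (intro convex_on_continuous) auto
    with \<open>x \<longlonglongrightarrow> d\<close> show "(\<lambda>n. l (x n) c) \<longlonglongrightarrow> l d c"
      by (auto intro: continuous_on_tendsto_compose)
  qed
qed

text \<open>For a simple function in place of \<open>g\<close> the composition is glued from
  finitely many sections. Continuity in the decision then carries measurability to the pointwise
  limit \<open>g\<close>.\<close>

lemma caratheodory_measurable:
  fixes l :: "'d::{metric_space, second_countable_topology} \<Rightarrow> 'c \<Rightarrow> real"
  assumes meas: "\<And>d. l d \<in> borel_measurable N"
    and cont: "\<And>c. c \<in> space N \<Longrightarrow> continuous_on UNIV (\<lambda>d. l d c)"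
    and g: "g \<in> borel_measurable M"
  shows "(\<lambda>(w, c). l (g w) c) \<in> borel_measurable (M \<Otimes>\<^sub>M N)"
proof -
  obtain F where F: "\<And>i. simple_function M (F i)" "\<And>w. w \<in> space M \<Longrightarrow> (\<lambda>i. F i w) \<longlonglongrightarrow> g w"
    using borel_measurable_implies_sequence_metric[OF g] by blast
  show ?thesis
  proof (rule borel_measurable_LIMSEQ_metric)
    show "(\<lambda>(w, c). l (F i w) c) \<in> borel_measurable (M \<Otimes>\<^sub>M N)" for i
      unfolding split_beta
    proof (rule measurable_compose_countable'[where I="F i ` space M" and g="\<lambda>x. F i (fst x)"])
      show "(\<lambda>x. l d (snd x)) \<in> borel_measurable (M \<Otimes>\<^sub>M N)" for d
        using meas by measurable
      have "F i \<in> M \<rightarrow>\<^sub>M count_space (F i ` space M)"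
        using F(1)[of i] by (auto simp: simple_function_def measurable_count_space_eq2)
      then show "(\<lambda>x. F i (fst x)) \<in> M \<Otimes>\<^sub>M N \<rightarrow>\<^sub>M count_space (F i ` space M)"
        by (rule measurable_compose[OF measurable_fst])
      show "countable (F i ` space M)"
        using F(1)[of i] by (auto simp: simple_function_def intro: countable_finite)
    qed
    fix x assume "x \<in> space (M \<Otimes>\<^sub>M N)"
    then show "(\<lambda>i. case x of (w, c) \<Rightarrow> l (F i w) c) \<longlonglongrightarrow> (case x of (w, c) \<Rightarrow> l (g w) c)"
      using continuous_on_tendsto_compose[OF cont F(2)] by (auto simp: space_pair_measure)
  qed
qed

section \<open>Conditional surrogate risk\<close>

text \<open>The surrogate hypotheses in the form in which they are used: extended conditional
  expectations have become Bochner integrals. They are imposed at every \<open>w\<close>, as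
  calibration is.\<close>

locale convex_surrogate = disintegration P M N \<kappa>
  for P :: "('a \<times> 'b) measure" and M :: "'a measure" and N :: "'b measure"
    and \<kappa> :: "'a \<Rightarrow> 'b measure" +
  fixes l :: "'d::euclidean_space \<Rightarrow> 'b \<Rightarrow> real"
  assumes meas_l: "\<And>d. l d \<in> borel_measurable N"
    and conv_l: "\<And>c. c \<in> space N \<Longrightarrow> convex_on UNIV (\<lambda>d. l d c)"
    and int_l: "\<And>w d. w \<in> space M \<Longrightarrow> integrable (\<kappa> w) (l d)"
    and min_l: "\<And>w. w \<in> space M \<Longrightarrow> \<exists>d\<^sub>0. \<forall>d. (\<integral>c. l d\<^sub>0 c \<partial>\<kappa> w) \<le> (\<integral>c. l d c \<partial>\<kappa> w)"
begin

definition cond_risk :: "'a \<Rightarrow> 'd \<Rightarrow> real" where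
  "cond_risk w d = (\<integral>c. l d c \<partial>\<kappa> w)"

definition min_cond_risk :: "'a \<Rightarrow> real" where
  "min_cond_risk w = (INF d. cond_risk w d)"

lemma measurable_loss:
  assumes "g \<in> borel_measurable M"
  shows "(\<lambda>(w, c). l (g w) c) \<in> borel_measurable (M \<Otimes>\<^sub>M N)"
  using convex_on_continuous[OF open_UNIV conv_l] assms
  by (intro caratheodory_measurable meas_l)

lemma measurable_cond_risk [measurable]:
  assumes "g \<in> borel_measurable M"
  shows "(\<lambda>w. cond_risk w (g w)) \<in> borel_measurable M"
  using borel_measurable_kernel_integral[OF measurable_loss[OF assms]]
  by (simp add: cond_risk_def)

lemma measurable_abs_loss:
  assumes "g \<in> borel_measurable M"
  shows "(\<lambda>w. \<integral>\<^sup>+ c. ennreal \<bar>l (g w) c\<bar> \<partial>\<kappa> w) \<in> borel_measurable M"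
  using measurable_loss[OF assms]
  by (intro nn_integral_measurable_subprob_algebra2[OF _ kernel_subprob]) (simp add: split_beta)

text \<open>Convexity survives integration, and a finite convex function on a Euclidean space is
  continuous.\<close>

lemma continuous_cond_risk:
  assumes w: "w \<in> space M"
  shows "continuous_on UNIV (cond_risk w)"
proof (intro convex_on_continuous open_UNIV convex_onI convex_UNIV)
  fix t :: real and x y :: 'd assume t: "0 < t" "t < 1"
  have "cond_risk w ((1 - t) *\<^sub>R x + t *\<^sub>R y) \<le> (\<integral>c. (1 - t) * l x c + t * l y c \<partial>\<kappa> w)"
    unfolding cond_risk_def
  proof (rule integral_mono)
    fix c assume "c \<in> space (\<kappa> w)"
    then show "l ((1 - t) *\<^sub>R x + t *\<^sub>R y) c \<le> (1 - t) * l x c + t * l y c"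
      using convex_onD[OF conv_l, of c t x y] t by (simp add: space_kernel[OF w])
  qed (use int_l[OF w] in auto)
  also have "\<dots> = (1 - t) * cond_risk w x + t * cond_risk w y"
    using int_l[OF w] by (simp add: cond_risk_def)
  finally show "cond_risk w ((1 - t) *\<^sub>R x + t *\<^sub>R y) \<le> (1 - t) * cond_risk w x + t * cond_risk w y" .
qed

lemma bdd_below_cond_risk: "w \<in> space M \<Longrightarrow> bdd_below (cond_risk w ` S)"
  using min_l[of w] by (auto simp: cond_risk_def bdd_below_def)

lemma min_cond_risk_le: "w \<in> space M \<Longrightarrow> min_cond_risk w \<le> cond_risk w d"
  unfolding min_cond_risk_def by (rule cINF_lower[OF bdd_below_cond_risk]) auto

text \<open>By continuity the strict sublevel set is open, and it is non-empty by definition of the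
  infimum; hence a dense sequence meets it.\<close>

lemma min_cond_risk_near:
  assumes w: "w \<in> space M" and "\<eta> > 0"
    and dense: "\<And>S. open S \<Longrightarrow> S \<noteq> {} \<Longrightarrow> \<exists>k::nat. D k \<in> S"
  shows "\<exists>k. cond_risk w (D k) < min_cond_risk w + \<eta>"
proof -
  let ?S = "{d. cond_risk w d < min_cond_risk w + \<eta>}"
  have "open ?S"
    by (rule open_Collect_less[OF continuous_cond_risk[OF w] continuous_on_const])
  moreover have "?S \<noteq> {}"
    using cInf_lessD[of "range (cond_risk w)" "min_cond_risk w + \<eta>"] \<open>\<eta> > 0\<close>
    by (auto simp: min_cond_risk_def)
  ultimately show ?thesis using dense[of ?S] by auto
qed

lemma ex_dense_sequence:
  "\<exists>D :: nat \<Rightarrow> 'd. \<forall>S. open S \<longrightarrow> S \<noteq> {} \<longrightarrow> (\<exists>k. D k \<in> S)"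
proof -
  obtain D :: "'d set" where D: "countable D" "\<And>S. open S \<Longrightarrow> S \<noteq> {} \<Longrightarrow> \<exists>d\<in>D. d \<in> S"
    by (erule countable_dense_setE)
  then have "D \<noteq> {}" using D(2)[of UNIV] by auto
  with D show ?thesis
    by (intro exI[of _ "from_nat_into D"]) (metis from_nat_into_surj)
qed

text \<open>The infimum over all decisions equals the one over a dense sequence, and countable
  infima preserve measurability.\<close>

lemma measurable_min_cond_risk [measurable]: "min_cond_risk \<in> borel_measurable M"
proof -
  obtain D :: "nat \<Rightarrow> 'd" where D: "\<And>S. open S \<Longrightarrow> S \<noteq> {} \<Longrightarrow> \<exists>k. D k \<in> S"
    using ex_dense_sequence by blast
  have "min_cond_risk w = (INF k. cond_risk w (D k))" if w: "w \<in> space M" for w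
  proof (rule antisym)
    have bdd: "bdd_below (range (\<lambda>k. cond_risk w (D k)))"
      using bdd_below_cond_risk[OF w, of "range D"] by (simp add: image_image)
    show "min_cond_risk w \<le> (INF k. cond_risk w (D k))"
      by (intro cINF_greatest min_cond_risk_le w) auto
    show "(INF k. cond_risk w (D k)) \<le> min_cond_risk w"
    proof (rule field_le_epsilon)
      fix \<eta> :: real assume "\<eta> > 0"
      then obtain k where "cond_risk w (D k) < min_cond_risk w + \<eta>"
        using min_cond_risk_near[OF w _ D] by blast
      then show "(INF k. cond_risk w (D k)) \<le> min_cond_risk w + \<eta>"
        by (intro cINF_lower2[OF bdd, of k]) auto
    qed
  qed
  moreover have "(\<lambda>w. INF k. cond_risk w (D k)) \<in> borel_measurable M"
  proof (rule borel_measurable_cINF)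
    show "bdd_below (range (\<lambda>k. cond_risk w (D k)))" if "w \<in> space M" for w
      using bdd_below_cond_risk[OF that, of "range D"] by (simp add: image_image)
  qed auto
  ultimately show ?thesis by (simp cong: measurable_cong)
qed

text \<open>
  A near-minimizer of the conditional risk, found by searching a dense sequence, may have infinite
  expected loss. It is therefore pasted into \<open>g\<close> only where its conditional expected absolute loss
  is at most \<open>n\<close>; letting \<open>n\<close> grow exhausts the whole space.
\<close>

lemma conditional_excess_bound:
  assumes g [measurable]: "g \<in> borel_measurable M" and int_g: "integrable P (\<lambda>(w, c). l (g w) c)"
    and \<delta>: "\<delta> > 0"
    and opt: "\<And>g'. g' \<in> borel_measurable M \<Longrightarrow> integrable P (\<lambda>(w, c). l (g' w) c) \<Longrightarrow>
      (\<integral>(w, c). l (g w) c \<partial>P) \<le> (\<integral>(w, c). l (g' w) c \<partial>P) + \<delta>"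
  shows "(\<integral>\<^sup>+ w. ennreal (cond_risk w (g w) - min_cond_risk w) \<partial>\<mu>) \<le> ennreal (2 * \<delta>)"
proof -
  obtain D :: "nat \<Rightarrow> 'd" where D: "\<And>S. open S \<Longrightarrow> S \<noteq> {} \<Longrightarrow> \<exists>k. D k \<in> S"
    using ex_dense_sequence by blast
  \<comment> \<open>Taking the first suitable index makes the selection measurable: it is decided by
    countably many measurable conditions.\<close>
  define s where "s w = D (LEAST k. cond_risk w (D k) < min_cond_risk w + \<delta>)" for w
  have s_meas [measurable]: "s \<in> borel_measurable M"
    unfolding s_def by measurable
  have s_near: "cond_risk w (s w) < min_cond_risk w + \<delta>" if "w \<in> space M" for w
    unfolding s_def by (rule LeastI_ex[OF min_cond_risk_near[OF that \<delta> D]])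
  define r where "r w = (\<integral>\<^sup>+ c. ennreal \<bar>l (s w) c\<bar> \<partial>\<kappa> w)" for w
  have r_meas [measurable]: "r \<in> borel_measurable M"
    unfolding r_def by (rule measurable_abs_loss[OF s_meas])
  define A where "A n = {w \<in> space M. r w \<le> of_nat n}" for n :: nat
  have A_meas [measurable]: "A n \<in> sets M" for n unfolding A_def by measurable
  let ?e = "\<lambda>w. cond_risk w (g w) - min_cond_risk w"
  have e_nonneg: "0 \<le> ?e w" if "w \<in> space M" for w using min_cond_risk_le[OF that] by simp
  have bound: "(\<integral>\<^sup>+ w. ennreal (?e w) * indicator (A n) w \<partial>\<mu>) \<le> ennreal (2 * \<delta>)" for n
  proof -
    define g' where "g' w = (if w \<in> A n then s w else g w)" for w
    have g' [measurable]: "g' \<in> borel_measurable M" unfolding g'_def by measurable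
    \<comment> \<open>On \<open>A n\<close> the conditional absolute loss of \<open>g'\<close> is at
      most \<open>n\<close>, elsewhere it is that of \<open>g\<close>. The first bound has a finite
      integral because \<open>\<mu>\<close> is a probability measure, the second because
      \<open>g\<close> has integrable loss.\<close>
    have int_g': "integrable P (\<lambda>(w, c). l (g' w) c)"
    proof (rule integrableI_bounded)
      show "(\<lambda>(w, c). l (g' w) c) \<in> borel_measurable P"
        by (rule measurable_P[OF measurable_loss[OF g']])
      have "(\<integral>\<^sup>+ x. ennreal (norm (case x of (w, c) \<Rightarrow> l (g' w) c)) \<partial>P)
          = (\<integral>\<^sup>+ w. \<integral>\<^sup>+ c. ennreal \<bar>l (g' w) c\<bar> \<partial>\<kappa> w \<partial>\<mu>)"
        using measurable_loss[OF g'] by (subst nn_integral_disintegrate) auto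
      also have "\<dots> \<le> (\<integral>\<^sup>+ w. of_nat n + (\<integral>\<^sup>+ c. ennreal \<bar>l (g w) c\<bar> \<partial>\<kappa> w) \<partial>\<mu>)"
      proof (rule nn_integral_mono)
        fix w assume "w \<in> space \<mu>"
        show "(\<integral>\<^sup>+ c. ennreal \<bar>l (g' w) c\<bar> \<partial>\<kappa> w)
            \<le> of_nat n + (\<integral>\<^sup>+ c. ennreal \<bar>l (g w) c\<bar> \<partial>\<kappa> w)"
          by (cases "w \<in> A n") (auto simp: g'_def A_def r_def add_increasing add_increasing2)
      qed
      also have "\<dots> = (\<integral>\<^sup>+ w. of_nat n \<partial>\<mu>) + (\<integral>\<^sup>+ w. \<integral>\<^sup>+ c. ennreal \<bar>l (g w) c\<bar> \<partial>\<kappa> w \<partial>\<mu>)"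
        using measurable_abs_loss[OF g] by (intro nn_integral_add) auto
      also have "(\<integral>\<^sup>+ w. \<integral>\<^sup>+ c. ennreal \<bar>l (g w) c\<bar> \<partial>\<kappa> w \<partial>\<mu>)
          = (\<integral>\<^sup>+ x. ennreal (norm (case x of (w, c) \<Rightarrow> l (g w) c)) \<partial>P)"
        using measurable_loss[OF g] by (subst nn_integral_disintegrate) auto
      also have "(\<integral>\<^sup>+ w. of_nat n \<partial>\<mu>) + \<dots> < \<infinity>"
        using int_g prob_space.emeasure_space_1[OF prob_space_\<mu>]
        by (auto simp: integrable_iff_bounded of_nat_less_top)
      finally show "(\<integral>\<^sup>+ x. ennreal (norm (case x of (w, c) \<Rightarrow> l (g' w) c)) \<partial>P) < \<infinity>" .
    qed
    note int = integrable_kernel_integral[OF measurable_loss[OF g] int_g]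
      integrable_kernel_integral[OF measurable_loss[OF g'] int_g']
    have i: "integrable \<mu> (\<lambda>w. cond_risk w (g w))" "integrable \<mu> (\<lambda>w. cond_risk w (g' w))"
      using int by (simp_all add: cond_risk_def)
    have "(\<integral>w. cond_risk w (g w) \<partial>\<mu>) \<le> (\<integral>w. cond_risk w (g' w) \<partial>\<mu>) + \<delta>"
      using opt[OF g' int_g'] integral_kernel_integral[OF measurable_loss[OF g] int_g]
        integral_kernel_integral[OF measurable_loss[OF g'] int_g']
      by (simp add: cond_risk_def)
    moreover have k: "integrable \<mu> (\<lambda>w. \<delta>)"
      by (rule finite_measure.integrable_const[OF prob_space.finite_measure[OF prob_space_\<mu>]])
    \<comment> \<open>The shift by \<delta> keeps the integrand nonnegative and lets it dominate the
      excess on \<open>A n\<close>, where \<open>s\<close> is optimal only up to \<delta>. The other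
      \<delta> is the slack granted to \<open>g\<close>.\<close>
    ultimately have le: "(\<integral>w. cond_risk w (g w) - cond_risk w (g' w) + \<delta> \<partial>\<mu>) \<le> 2 * \<delta>"
      using i prob_space.prob_space[OF prob_space_\<mu>] by simp
    have pos: "?e w * indicator (A n) w \<le> cond_risk w (g w) - cond_risk w (g' w) + \<delta>"
      if "w \<in> space M" for w
      using s_near[OF that] \<delta> by (auto simp: g'_def indicator_def)
    have "(\<integral>\<^sup>+ w. ennreal (?e w) * indicator (A n) w \<partial>\<mu>)
        \<le> (\<integral>\<^sup>+ w. ennreal (cond_risk w (g w) - cond_risk w (g' w) + \<delta>) \<partial>\<mu>)"
    proof (rule nn_integral_mono)
      fix w assume "w \<in> space \<mu>"
      then have w: "w \<in> space M" by simp
      have "ennreal (?e w) * indicator (A n) w = ennreal (?e w * indicator (A n) w)"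
        by (simp add: indicator_def)
      also have "\<dots> \<le> ennreal (cond_risk w (g w) - cond_risk w (g' w) + \<delta>)"
        by (rule ennreal_leI[OF pos[OF w]])
      finally show "ennreal (?e w) * indicator (A n) w
          \<le> ennreal (cond_risk w (g w) - cond_risk w (g' w) + \<delta>)" .
    qed
    also have "\<dots> = ennreal (\<integral>w. cond_risk w (g w) - cond_risk w (g' w) + \<delta> \<partial>\<mu>)"
    proof (rule nn_integral_eq_integral)
      show "AE w in \<mu>. 0 \<le> cond_risk w (g w) - cond_risk w (g' w) + \<delta>"
      proof (rule AE_I2)
        fix w assume "w \<in> space \<mu>"
        then have w: "w \<in> space M" by simp
        have "0 \<le> ?e w * indicator (A n) w" using e_nonneg[OF w] by simp
        with pos[OF w] show "0 \<le> cond_risk w (g w) - cond_risk w (g' w) + \<delta>" by linarith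
      qed
    qed (use i k in auto)
    also have "\<dots> \<le> ennreal (2 * \<delta>)" by (rule ennreal_leI[OF le])
    finally show ?thesis .
  qed
  have r_fin: "r w < \<infinity>" if w: "w \<in> space M" for w
    using int_l[OF w, of "s w"] by (simp add: r_def integrable_iff_bounded)
  have "(\<integral>\<^sup>+ w. ennreal (?e w) \<partial>\<mu>) = (\<integral>\<^sup>+ w. (SUP n. ennreal (?e w) * indicator (A n) w) \<partial>\<mu>)"
  proof (rule nn_integral_cong)
    fix w assume "w \<in> space \<mu>"
    then have w: "w \<in> space M" by simp
    obtain n where "r w \<le> of_nat n"
      using ennreal_Ex_less_of_nat[of "r w"] r_fin[OF w] by (auto intro: less_imp_le)
    then have "ennreal (?e w) \<le> ennreal (?e w) * indicator (A n) w"
      using w by (simp add: A_def)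
    also have "\<dots> \<le> (SUP n. ennreal (?e w) * indicator (A n) w)" by (rule SUP_upper) simp
    finally show "ennreal (?e w) = (SUP n. ennreal (?e w) * indicator (A n) w)"
      by (intro antisym SUP_least) (auto simp: indicator_def)
  qed
  also have "\<dots> = (SUP n. \<integral>\<^sup>+ w. ennreal (?e w) * indicator (A n) w \<partial>\<mu>)"
  proof (rule nn_integral_monotone_convergence_SUP)
    show "incseq (\<lambda>n w. ennreal (?e w) * indicator (A n) w)"
      using order_trans[OF _ of_nat_mono[where 'a=ennreal]]
      by (auto simp: incseq_def le_fun_def indicator_def A_def split: if_splits)
  qed measurable
  also have "\<dots> \<le> ennreal (2 * \<delta>)" by (rule SUP_least) (rule bound)
  finally show ?thesis .
qed

text \<open>Convergence in L1 alone would give almost sure convergence only along a subsequence. The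
  geometric bound makes the integral of the series finite, so almost every series of excesses
  converges. The factor 2 is that of \<open>conditional_excess_bound\<close>.\<close>

lemma AE_cond_excess_tendsto_0:
  assumes g: "\<And>n. g n \<in> borel_measurable M"
    and bound: "\<And>n. (\<integral>\<^sup>+ w. ennreal (cond_risk w (g n w) - min_cond_risk w) \<partial>\<mu>) \<le> ennreal (2 * (1 / 2) ^ n)"
  shows "AE w in \<mu>. (\<lambda>n. cond_risk w (g n w) - min_cond_risk w) \<longlonglongrightarrow> 0"
proof -
  let ?e = "\<lambda>n w. cond_risk w (g n w) - min_cond_risk w"
  note [measurable] = g
  have "(\<integral>\<^sup>+ w. (\<Sum>n. ennreal (?e n w)) \<partial>\<mu>) = (\<Sum>n. \<integral>\<^sup>+ w. ennreal (?e n w) \<partial>\<mu>)"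
    by (rule nn_integral_suminf) measurable
  also have "\<dots> \<le> (\<Sum>n. ennreal (2 * (1 / 2) ^ n))"
    by (intro suminf_le bound) auto
  also have "\<dots> < \<infinity>"
    by (subst suminf_ennreal2) (auto intro!: summable_mult summable_geometric)
  finally have "AE w in \<mu>. (\<Sum>n. ennreal (?e n w)) \<noteq> \<infinity>"
    by (intro nn_integral_PInf_AE) auto
  then show ?thesis
  proof (rule AE_mp, intro AE_I2 impI)
    fix w assume "w \<in> space \<mu>" and fin: "(\<Sum>n. ennreal (?e n w)) \<noteq> \<infinity>"
    then have "summable (\<lambda>n. ?e n w)"
      using min_cond_risk_le[of w] by (intro summable_suminf_not_top) auto
    then show "(\<lambda>n. ?e n w) \<longlonglongrightarrow> 0" by (rule summable_LIMSEQ_zero)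
  qed
qed

end

section \<open>Conditional regret of the true loss\<close>

locale linear_objective =
  fixes X :: "(real^'m) set" and f :: "real^'m \<Rightarrow> real" and xstar :: "real^'m \<Rightarrow> real^'m"
  assumes compact_X: "compact X"
    and continuous_f: "continuous_on X f"
    and xstar: "\<And>d. xstar d \<in> argmin_on (\<lambda>x. f x + d \<bullet> x) X"
begin

text \<open>As a function of \<open>c\<close> this is minus the Fenchel conjugate, at
  \<open>- c\<close>, of \<open>f\<close> restricted to \<open>X\<close>; in particular it is
  concave. It is the part of the true loss on which the decision has no influence.\<close>

definition opt_value :: "real^'m \<Rightarrow> real" where
  "opt_value c = (INF x\<in>X. f x + c \<bullet> x)"

lemma xstar_in: "xstar d \<in> X"
  and xstar_min: "x \<in> X \<Longrightarrow> f (xstar d) + d \<bullet> xstar d \<le> f x + d \<bullet> x"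
  using xstar[of d] by (auto simp: argmin_on_def is_arg_min_def not_less)

lemma opt_value_eq: "opt_value c = f (xstar c) + c \<bullet> xstar c"
  unfolding opt_value_def
  by (intro cInf_eq_minimum) (auto intro: xstar_in xstar_min)

lemma opt_value_le: "x \<in> X \<Longrightarrow> opt_value c \<le> f x + c \<bullet> x"
  by (simp add: opt_value_eq xstar_min)

lemma true_loss_eq: "true_loss X f xstar d c = f (xstar d) + c \<bullet> xstar d - opt_value c"
  by (simp add: true_loss_def opt_value_def)

lemma true_loss_nonneg: "0 \<le> true_loss X f xstar d c"
  using opt_value_le[OF xstar_in] by (simp add: true_loss_eq)

lemma true_loss_self: "true_loss X f xstar c c = 0"
  by (simp add: true_loss_eq opt_value_eq)

text \<open>A single constant serves the norm on \<open>X\<close> and the values of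
  \<open>f\<close>; compactness shows that the choice is not vacuous.\<close>

definition bnd :: real where
  "bnd = (SOME b. 0 \<le> b \<and> (\<forall>x\<in>X. norm x \<le> b \<and> \<bar>f x\<bar> \<le> b))"

lemma bnd: "0 \<le> bnd" "x \<in> X \<Longrightarrow> norm x \<le> bnd" "x \<in> X \<Longrightarrow> \<bar>f x\<bar> \<le> bnd"
proof -
  obtain a where a: "\<forall>x\<in>X. norm x \<le> a"
    using compact_imp_bounded[OF compact_X] by (auto simp: bounded_iff)
  obtain b where b: "\<forall>x\<in>X. \<bar>f x\<bar> \<le> b"
    using compact_imp_bounded[OF compact_continuous_image[OF continuous_f compact_X]]
    by (auto simp: bounded_iff)
  have "0 \<le> max 0 (max a b) \<and> (\<forall>x\<in>X. norm x \<le> max 0 (max a b) \<and> \<bar>f x\<bar> \<le> max 0 (max a b))"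
    using a b by (auto simp: le_max_iff_disj)
  then have "0 \<le> bnd \<and> (\<forall>x\<in>X. norm x \<le> bnd \<and> \<bar>f x\<bar> \<le> bnd)"
    unfolding bnd_def by (rule someI)
  then show "0 \<le> bnd" "x \<in> X \<Longrightarrow> norm x \<le> bnd" "x \<in> X \<Longrightarrow> \<bar>f x\<bar> \<le> bnd" by auto
qed

lemma abs_inner_le: "x \<in> X \<Longrightarrow> \<bar>c \<bullet> x\<bar> \<le> bnd * norm c"
  using Cauchy_Schwarz_ineq2[of c x] mult_left_mono[OF bnd(2), of x "norm c"]
  by (simp add: mult.commute)

lemma abs_objective_le: "x \<in> X \<Longrightarrow> \<bar>f x + c \<bullet> x\<bar> \<le> bnd + bnd * norm c"
  using bnd(3) abs_inner_le[of x c] by fastforce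

lemma abs_opt_value_le: "\<bar>opt_value c\<bar> \<le> bnd + bnd * norm c"
  unfolding opt_value_eq by (rule abs_objective_le[OF xstar_in])

lemma abs_true_loss_le: "\<bar>true_loss X f xstar d c\<bar> \<le> 2 * (bnd + bnd * norm c)"
  using abs_objective_le[OF xstar_in, of d c] abs_opt_value_le[of c] by (simp add: true_loss_eq)

text \<open>An infimum of affine functions with slopes in the bounded set \<open>X\<close> is
  Lipschitz: the minimizer at \<open>c'\<close> is a competitor at \<open>c\<close>, and the two
  objectives differ there by at most \<open>bnd * norm (c - c')\<close>.\<close>

lemma measurable_opt_value [measurable]: "opt_value \<in> borel_measurable borel"
proof -
  have le: "opt_value c - opt_value c' \<le> bnd * norm (c - c')" for c c'
    using opt_value_le[OF xstar_in, of c c'] abs_inner_le[OF xstar_in, of "c - c'" c']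
    by (simp add: opt_value_eq[of c'] inner_diff_left)
  have "bnd-lipschitz_on UNIV opt_value"
  proof (rule lipschitz_onI)
    show "dist (opt_value c) (opt_value c') \<le> bnd * dist c c'" for c c'
      using le[of c c'] le[of c' c] by (simp add: dist_norm norm_minus_commute abs_le_iff)
  qed (rule bnd)
  then show ?thesis
    by (intro borel_measurable_continuous_onI lipschitz_on_continuous_on)
qed

text \<open>\<open>f\<close> is controlled on \<open>X\<close> only, so \<open>h\<close> has to be
  regarded as a map into the subspace \<open>X\<close>.\<close>

lemma measurable_f_compose:
  assumes "h \<in> borel_measurable M" "\<And>w. h w \<in> X"
  shows "(\<lambda>w. f (h w)) \<in> borel_measurable M"
proof (rule measurable_compose[where f=h])
  show "h \<in> M \<rightarrow>\<^sub>M restrict_space borel X"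
    using assms by (intro measurable_restrict_space2) auto
  show "f \<in> borel_measurable (restrict_space borel X)"
    by (rule borel_measurable_continuous_on_restrict[OF continuous_f])
qed

context
  fixes Q :: "(real^'m) measure"
  assumes Q: "prob_space Q" and meas_Q [measurable]: "(\<lambda>c. c) \<in> borel_measurable Q"
    and int_Q: "integrable Q (\<lambda>c. c)"
begin

lemma integrable_opt_value: "integrable Q opt_value"
proof (rule Bochner_Integration.integrable_bound)
  interpret prob_space Q by (rule Q)
  show "integrable Q (\<lambda>c. bnd + bnd * norm c)" using int_Q by auto
  show "AE c in Q. norm (opt_value c) \<le> norm (bnd + bnd * norm c)"
    using abs_opt_value_le bnd(1) by auto
  show "opt_value \<in> borel_measurable Q"
    using measurable_compose[OF meas_Q measurable_opt_value] by simp
qed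

text \<open>\<open>Q\<close> stands for \<open>\<kappa> w\<close> at a \<open>w\<close> where
  \<open>c\<close> is integrable. The loss is affine in \<open>c\<close> except for
  \<open>opt_value c\<close>, so averaging adds to the loss at the mean only the Jensen gap of
  \<open>opt_value\<close>, which does not involve \<open>d\<close>.\<close>

lemma has_bochner_integral_true_loss:
  "has_bochner_integral Q (true_loss X f xstar d)
    (true_loss X f xstar d (\<integral>c. c \<partial>Q) + (opt_value (\<integral>c. c \<partial>Q) - (\<integral>c. opt_value c \<partial>Q)))"
proof -
  interpret prob_space Q by (rule Q)
  have "has_bochner_integral Q (\<lambda>c. f (xstar d) + c \<bullet> xstar d - opt_value c)
      (f (xstar d) + (\<integral>c. c \<partial>Q) \<bullet> xstar d - (\<integral>c. opt_value c \<partial>Q))"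
    using int_Q integrable_opt_value by (simp add: has_bochner_integral_iff prob_space)
  then show ?thesis by (simp add: true_loss_eq[abs_def] add_diff_eq)
qed

text \<open>Deciding for the mean itself makes the loss at the mean 0. The infimum is therefore
  exactly the Jensen gap, which cancels in the excess.\<close>

lemma ext_excess_true_loss:
  "ext_expectation Q (true_loss X f xstar d) - (INF d'. ext_expectation Q (true_loss X f xstar d'))
    = ereal (true_loss X f xstar d (\<integral>c. c \<partial>Q))"
proof -
  let ?m = "\<integral>c. c \<partial>Q" and ?K = "opt_value (\<integral>c. c \<partial>Q) - (\<integral>c. opt_value c \<partial>Q)"
  have e: "ext_expectation Q (true_loss X f xstar d) = ereal (true_loss X f xstar d ?m + ?K)" for d
    using has_bochner_integral_true_loss[of d]
    by (simp add: has_bochner_integral_iff ext_expectation_eq_integral)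
  have "(INF d'. ext_expectation Q (true_loss X f xstar d')) = ereal ?K"
  proof (rule antisym)
    show "(INF d'. ext_expectation Q (true_loss X f xstar d')) \<le> ereal ?K"
      by (rule INF_lower2[of ?m]) (simp_all add: e true_loss_self)
    show "ereal ?K \<le> (INF d'. ext_expectation Q (true_loss X f xstar d'))"
      by (rule INF_greatest) (simp add: e true_loss_nonneg)
  qed
  then show ?thesis by (simp add: e)
qed

end

end

locale stochastic_objective = disintegration P M N \<kappa> + linear_objective X f xstar
  for P :: "('a \<times> (real^'m)) measure" and M :: "'a measure" and N :: "(real^'m) measure"
    and \<kappa> :: "'a \<Rightarrow> (real^'m) measure" and X :: "(real^'m) set"
    and f :: "real^'m \<Rightarrow> real" and xstar :: "real^'m \<Rightarrow> real^'m" +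
  assumes meas_c [measurable]: "(\<lambda>c. c) \<in> borel_measurable N"
    and int_c: "integrable P snd"
begin

definition cond_mean :: "'a \<Rightarrow> real^'m" where
  "cond_mean w = (\<integral>c. c \<partial>\<kappa> w)"

lemma measurable_snd_borel: "snd \<in> borel_measurable (M \<Otimes>\<^sub>M N)"
  using measurable_compose[OF measurable_snd meas_c] by simp

lemma measurable_cond_mean [measurable]: "cond_mean \<in> borel_measurable M"
  using borel_measurable_kernel_integral[OF measurable_snd_borel] by (simp add: cond_mean_def[abs_def])

text \<open>The disintegration of integrals is stated for real integrands, so the vector
  \<open>c\<close> is handled through its norm.\<close>

lemma AE_integrable_kernel_id: "AE w in \<mu>. integrable (\<kappa> w) (\<lambda>c. c)"
proof -
  have "AE w in \<mu>. integrable (\<kappa> w) (\<lambda>c. norm (snd (w, c)))"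
    by (rule AE_integrable_kernel) (use measurable_snd_borel int_c in auto)
  then show ?thesis
  proof (rule AE_mp, intro AE_I2 impI)
    fix w assume "w \<in> space \<mu>" "integrable (\<kappa> w) (\<lambda>c. norm (snd (w, c)))"
    then show "integrable (\<kappa> w) (\<lambda>c. c)"
      using measurable_kernel[OF _ meas_c, of w] by (simp add: integrable_norm_iff)
  qed
qed

text \<open>This supplies the dominating function for the conditional regrets. The norm of the
  conditional mean is at most the conditional mean of the norm, even where \<open>c\<close> is not
  integrable, since both integrals are then 0.\<close>

lemma integrable_cond_mean_bound: "integrable \<mu> (\<lambda>w. bnd + bnd * norm (cond_mean w))"
proof -
  interpret \<mu>: prob_space \<mu> by (rule prob_space_\<mu>)
  have i: "integrable \<mu> (\<lambda>w. \<integral>c. norm (snd (w, c)) \<partial>\<kappa> w)"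
    by (rule integrable_kernel_integral) (use measurable_snd_borel int_c in auto)
  have "integrable \<mu> cond_mean"
  proof (rule Bochner_Integration.integrable_bound[OF i])
    show "AE w in \<mu>. norm (cond_mean w) \<le> norm (\<integral>c. norm (snd (w, c)) \<partial>\<kappa> w)"
      unfolding cond_mean_def
      by (intro AE_I2) (auto intro!: order_trans[OF integral_norm_bound])
  qed measurable
  then show ?thesis by auto
qed

lemma measurable_true_loss_cond_mean:
  assumes "(\<lambda>w. xstar (g w)) \<in> borel_measurable M"
  shows "(\<lambda>w. true_loss X f xstar (g w) (cond_mean w)) \<in> borel_measurable M"
  using assms measurable_f_compose[OF assms xstar_in] by (simp add: true_loss_eq)

lemma integrable_true_loss_cond_mean:
  assumes "(\<lambda>w. xstar (g w)) \<in> borel_measurable M"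
  shows "integrable \<mu> (\<lambda>w. true_loss X f xstar (g w) (cond_mean w))"
proof (rule Bochner_Integration.integrable_bound)
  show "integrable \<mu> (\<lambda>w. 2 * (bnd + bnd * norm (cond_mean w)))"
    by (rule integrable_mult_right[OF integrable_cond_mean_bound])
  show "(\<lambda>w. true_loss X f xstar (g w) (cond_mean w)) \<in> borel_measurable \<mu>"
    using measurable_true_loss_cond_mean[OF assms] by simp
  show "AE w in \<mu>. norm (true_loss X f xstar (g w) (cond_mean w))
      \<le> norm (2 * (bnd + bnd * norm (cond_mean w)))"
    using abs_true_loss_le order_trans[OF _ abs_ge_self] by (intro AE_I2) (auto simp: real_norm_def)
qed

text \<open>Conditioning on \<open>w\<close> separates the expected regret, which is nonnegative,
  from the expected Jensen gap, which is the same for all rules. Comparing risks thus amounts to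
  comparing expected regrets.\<close>

lemma risk_true_loss:
  assumes g [measurable]: "(\<lambda>w. xstar (g w)) \<in> borel_measurable M"
  shows "risk P (true_loss X f xstar) g =
    ereal ((\<integral>w. true_loss X f xstar (g w) (cond_mean w) \<partial>\<mu>) +
      (\<integral>w. opt_value (cond_mean w) - (\<integral>c. opt_value c \<partial>\<kappa> w) \<partial>\<mu>))"
proof -
  interpret \<mu>: prob_space \<mu> by (rule prob_space_\<mu>)
  note [measurable] = measurable_f_compose[OF g xstar_in] measurable_snd_borel
  let ?L = "\<lambda>x. true_loss X f xstar (g (fst x)) (snd x)"
  have m: "?L \<in> borel_measurable (M \<Otimes>\<^sub>M N)"
    unfolding true_loss_eq by measurable
  have i: "integrable P (\<lambda>x. bnd + bnd * norm (snd x))"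
    using int_c by auto
  have iL: "integrable P ?L"
  proof (rule Bochner_Integration.integrable_bound)
    show "integrable P (\<lambda>x. 2 * (bnd + bnd * norm (snd x)))"
      by (rule integrable_mult_right[OF i])
    show "?L \<in> borel_measurable P" by (rule measurable_P[OF m])
    show "AE x in P. norm (?L x) \<le> norm (2 * (bnd + bnd * norm (snd x)))"
      using abs_true_loss_le order_trans[OF _ abs_ge_self] by (intro AE_I2) (auto simp: real_norm_def)
  qed
  have mo: "(\<lambda>x. opt_value (snd x)) \<in> borel_measurable (M \<Otimes>\<^sub>M N)" by measurable
  have io: "integrable P (\<lambda>x. opt_value (snd x))"
  proof (rule Bochner_Integration.integrable_bound[OF i])
    show "(\<lambda>x. opt_value (snd x)) \<in> borel_measurable P" by (rule measurable_P[OF mo])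
    show "AE x in P. norm (opt_value (snd x)) \<le> norm (bnd + bnd * norm (snd x))"
      using abs_opt_value_le order_trans[OF _ abs_ge_self] by (intro AE_I2) (auto simp: real_norm_def)
  qed
  have "integrable \<mu> (\<lambda>w. opt_value (cond_mean w))"
  proof (rule Bochner_Integration.integrable_bound[OF integrable_cond_mean_bound])
    show "AE w in \<mu>. norm (opt_value (cond_mean w)) \<le> norm (bnd + bnd * norm (cond_mean w))"
      using abs_opt_value_le order_trans[OF _ abs_ge_self] by (intro AE_I2) (auto simp: real_norm_def)
  qed measurable
  then have iK: "integrable \<mu> (\<lambda>w. opt_value (cond_mean w) - (\<integral>c. opt_value c \<partial>\<kappa> w))"
    using integrable_kernel_integral[OF mo io] by (intro Bochner_Integration.integrable_diff) auto
  have "(\<integral>x. ?L x \<partial>P) = (\<integral>w. \<integral>c. ?L (w, c) \<partial>\<kappa> w \<partial>\<mu>)"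
    by (rule integral_kernel_integral[OF m iL])
  also have "\<dots> = (\<integral>w. true_loss X f xstar (g w) (cond_mean w) +
      (opt_value (cond_mean w) - (\<integral>c. opt_value c \<partial>\<kappa> w)) \<partial>\<mu>)"
  proof (rule integral_cong_AE)
    show "(\<lambda>w. \<integral>c. ?L (w, c) \<partial>\<kappa> w) \<in> borel_measurable \<mu>"
      using borel_measurable_kernel_integral[OF m] by simp
    show "(\<lambda>w. true_loss X f xstar (g w) (cond_mean w) +
        (opt_value (cond_mean w) - (\<integral>c. opt_value c \<partial>\<kappa> w))) \<in> borel_measurable \<mu>"
      using iK integrable_true_loss_cond_mean[OF g] by (intro borel_measurable_add) auto
    show "AE w in \<mu>. (\<integral>c. ?L (w, c) \<partial>\<kappa> w) = true_loss X f xstar (g w) (cond_mean w) +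
        (opt_value (cond_mean w) - (\<integral>c. opt_value c \<partial>\<kappa> w))"
      using AE_integrable_kernel_id
    proof (rule AE_mp, intro AE_I2 impI)
      fix w assume w: "w \<in> space \<mu>" and "integrable (\<kappa> w) (\<lambda>c. c)"
      then show "(\<integral>c. ?L (w, c) \<partial>\<kappa> w) = true_loss X f xstar (g w) (cond_mean w) +
          (opt_value (cond_mean w) - (\<integral>c. opt_value c \<partial>\<kappa> w))"
        using has_bochner_integral_integral_eq[OF has_bochner_integral_true_loss[of "\<kappa> w" "g w"]]
          prob_space_kernel[of w] measurable_kernel[OF _ meas_c, of w]
        by (simp add: cond_mean_def)
    qed
  qed
  also have "\<dots> = (\<integral>w. true_loss X f xstar (g w) (cond_mean w) \<partial>\<mu>) +
      (\<integral>w. opt_value (cond_mean w) - (\<integral>c. opt_value c \<partial>\<kappa> w) \<partial>\<mu>)"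
    by (rule Bochner_Integration.integral_add[OF integrable_true_loss_cond_mean[OF g] iK])
  finally show ?thesis
    unfolding risk_def split_beta by (simp add: ext_expectation_eq_integral[OF iL])
qed

end

section \<open>Risk bounds from calibration\<close>

text \<open>Borel maps need not be measurable between completions. A projection is, because it pulls
  null sets back to null cylinders.\<close>

lemma fst_lebesgue_measurable:
  "fst \<in> (lebesgue :: ('a::euclidean_space \<times> 'b::euclidean_space) measure) \<rightarrow>\<^sub>M lebesgue"
proof (rule completion.measurable_completion2)
  show m: "fst \<in> (lebesgue :: ('a \<times> 'b) measure) \<rightarrow>\<^sub>M lborel"
    by (rule measurable_completion, simp)
      (intro borel_measurable_continuous_onI continuous_intros)
  show "null_sets lborel \<subseteq> null_sets (distr (lebesgue :: ('a \<times> 'b) measure) lborel fst)"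
  proof
    fix A :: "'a set" assume A: "A \<in> null_sets lborel"
    \<comment> \<open>The second factor has infinite measure; \<open>0 * \<infinity> = 0\<close> in
      \<open>ennreal\<close> still makes the cylinder null.\<close>
    then have "emeasure (lborel \<Otimes>\<^sub>M lborel) (A \<times> (UNIV :: 'b set)) = 0"
      by (subst lborel.emeasure_pair_measure_Times) (auto simp: null_sets_def)
    moreover have "fst -` A = A \<times> (UNIV :: 'b set)" by auto
    moreover have "A \<times> (UNIV :: 'b set) \<in> sets lborel"
      using A by (subst lborel_prod[symmetric]) auto
    ultimately show "A \<in> null_sets (distr (lebesgue :: ('a \<times> 'b) measure) lborel fst)"
      using A m by (auto simp: null_sets_def emeasure_distr lborel_prod)
  qed
qed

lemma snd_lebesgue_measurable:
  "snd \<in> (lebesgue :: ('a::euclidean_space \<times> 'b::euclidean_space) measure) \<rightarrow>\<^sub>M lebesgue"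
proof (rule completion.measurable_completion2)
  show m: "snd \<in> (lebesgue :: ('a \<times> 'b) measure) \<rightarrow>\<^sub>M lborel"
    by (rule measurable_completion, simp)
      (intro borel_measurable_continuous_onI continuous_intros)
  show "null_sets lborel \<subseteq> null_sets (distr (lebesgue :: ('a \<times> 'b) measure) lborel snd)"
  proof
    fix B :: "'b set" assume B: "B \<in> null_sets lborel"
    then have "emeasure (lborel \<Otimes>\<^sub>M lborel) ((UNIV :: 'a set) \<times> B) = 0"
      by (subst lborel.emeasure_pair_measure_Times) (auto simp: null_sets_def)
    moreover have "snd -` B = (UNIV :: 'a set) \<times> B" by auto
    moreover have "(UNIV :: 'a set) \<times> B \<in> sets lborel"
      using B by (subst lborel_prod[symmetric]) auto
    ultimately show "B \<in> null_sets (distr (lebesgue :: ('a \<times> 'b) measure) lborel snd)"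
      using B m by (auto simp: null_sets_def emeasure_distr lborel_prod)
  qed
qed

lemma measurable_lebesgue_on_Times:
  assumes "sets P = sets (lebesgue_on (W \<times> C))"
  shows "fst \<in> P \<rightarrow>\<^sub>M lebesgue_on W" "snd \<in> P \<rightarrow>\<^sub>M lebesgue_on C"
  unfolding measurable_cong_sets[OF assms refl]
  by (rule measurable_restrict_space3; use fst_lebesgue_measurable snd_lebesgue_measurable in auto)+

theorem theorem1:
  fixes X :: "(real^'m) set" and f :: "real^'m \<Rightarrow> real" and xstar :: "real^'m \<Rightarrow> real^'m"
    and W :: "(real^'k) set" and C :: "(real^'m) set"
    and P :: "((real^'k) \<times> (real^'m)) measure" and \<kappa> :: "real^'k \<Rightarrow> (real^'m) measure"
    and l :: "real^'m \<Rightarrow> real^'m \<Rightarrow> real"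
  assumes "X \<noteq> {}" and "convex X" and "compact X"
    and "convex_on X f" and "continuous_on X f"
    and "\<And>d. xstar d \<in> argmin_on (\<lambda>x. f x + d \<bullet> x) X"
    and "prob_space P" and "sets P = sets (lebesgue_on (W \<times> C))"
    and "regular_cond_distribution P (lebesgue_on W) (lebesgue_on C) \<kappa>"
    and "(\<lambda>(d, c). l d c) \<in> borel_measurable lebesgue"
    and "calibrated W \<kappa> (true_loss X f xstar) l"
    and "\<And>c. c \<in> C \<Longrightarrow> convex_on UNIV (\<lambda>d. l d c)"
    and "\<And>w. w \<in> W \<Longrightarrow> argmin_on (\<lambda>d. ext_expectation (\<kappa> w) (l d)) UNIV \<noteq> {}"
    and "\<And>w. w \<in> W \<Longrightarrow> bounded (argmin_on (\<lambda>d. ext_expectation (\<kappa> w) (l d)) UNIV)"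
    and "\<And>w d. w \<in> W \<Longrightarrow> ext_expectation (\<kappa> w) (l d) < \<infinity>"
    and "integrable P (\<lambda>(w, c). \<Sum>i\<in>UNIV. \<bar>c $ i\<bar>)"
  shows "\<forall>\<epsilon>::real. \<epsilon> > 0 \<longrightarrow> (\<exists>\<delta>::real. \<delta> > 0 \<and>
    (\<forall>g \<in> evaluable_rules W xstar.
      \<bar>risk P l g\<bar> \<noteq> \<infinity> \<longrightarrow>
      risk P l g \<le> optimal_risk (decision_rules W) P l + ereal \<delta> \<longrightarrow>
      risk P (true_loss X f xstar) g
        \<le> optimal_risk (evaluable_rules W xstar) P (true_loss X f xstar) + ereal \<epsilon>))"
proof -
  let ?M = "lebesgue_on W" and ?N = "lebesgue_on C" and ?L = "true_loss X f xstar"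
  interpret disintegration P ?M ?N \<kappa>
  proof (intro disintegration.intro disintegration_axioms.intro)
    show "space P = space ?M \<times> space ?N"
      using sets_eq_imp_space_eq[OF assms(8)] by simp
  qed (use assms(7,9) measurable_lebesgue_on_Times[OF assms(8)] in auto)
  have meas_c: "(\<lambda>c. c) \<in> borel_measurable ?N"
    by (rule measurable_restrict_space1, rule measurable_completion) simp
  have int_c: "integrable P snd"
  proof (rule Bochner_Integration.integrable_bound[OF assms(16)])
    show "snd \<in> borel_measurable P" using measurable_compose[OF snd_P meas_c] by simp
    show "AE x in P. norm (snd x) \<le> norm (case x of (w, c) \<Rightarrow> \<Sum>i\<in>UNIV. \<bar>c $ i\<bar>)"
      by (intro AE_I2) (auto intro: norm_le_l1_cart)
  qed
  interpret stochastic_objective P ?M ?N \<kappa> X f xstar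
    by unfold_locales (use assms(3,5,6) meas_c int_c in auto)
  \<comment> \<open>Boundedness of the minimizers enters here: it upgrades conditional expectations
    below \<infinity> to integrability.\<close>
  have loss_integrable: "integrable (\<kappa> w) (l d)" if "w \<in> W" for w d
    using assms(12,14,15) that space_kernel[of w] by (intro integrable_convex_loss) auto
  have ext_l: "ext_expectation (\<kappa> w) (l d) = ereal (\<integral>c. l d c \<partial>\<kappa> w)" if "w \<in> W" for w d
    by (rule ext_expectation_eq_integral[OF loss_integrable[OF that]])
  have loss_minimum: "\<exists>d\<^sub>0. \<forall>d. (\<integral>c. l d\<^sub>0 c \<partial>\<kappa> w) \<le> (\<integral>c. l d c \<partial>\<kappa> w)" if "w \<in> W" for w
    using assms(13)[OF that] ext_l[OF that] by (auto simp: argmin_on_def is_arg_min_def not_less)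
  interpret convex_surrogate P ?M ?N \<kappa> l
    by unfold_locales
      (use measurable_convex_section[OF assms(10,12)] assms(12) loss_integrable loss_minimum in auto)
  have inf_l: "(INF d. ext_expectation (\<kappa> w) (l d)) = ereal (min_cond_risk w)" if w: "w \<in> W" for w
  proof (rule antisym)
    obtain d\<^sub>0 where "\<And>d. cond_risk w d\<^sub>0 \<le> cond_risk w d"
      using loss_minimum[OF w] by (auto simp: cond_risk_def)
    then have "cond_risk w d\<^sub>0 \<le> min_cond_risk w"
      unfolding min_cond_risk_def by (intro cINF_greatest) auto
    then show "(INF d. ext_expectation (\<kappa> w) (l d)) \<le> ereal (min_cond_risk w)"
      using ext_l[OF w, of d\<^sub>0] by (intro INF_lower2[of d\<^sub>0]) (auto simp: cond_risk_def)
    show "ereal (min_cond_risk w) \<le> (INF d. ext_expectation (\<kappa> w) (l d))"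
      using min_cond_risk_le[of w] w by (intro INF_greatest) (auto simp: ext_l cond_risk_def)
  qed
  \<comment> \<open>Both extended excesses are real numbers at such \<open>w\<close>, so calibration
    turns into a statement about \<open>cond_risk\<close> and the loss at the conditional
    mean.\<close>
  have calib: "\<exists>\<delta>>0. \<forall>d. cond_risk w d - min_cond_risk w < \<delta> \<longrightarrow> ?L d (cond_mean w) < \<epsilon>"
    if w: "w \<in> W" and "integrable (\<kappa> w) (\<lambda>c. c)" and "\<epsilon> > 0" for w and \<epsilon> :: real
  proof -
    have "ext_expectation (\<kappa> w) (?L d) - (INF d'. ext_expectation (\<kappa> w) (?L d'))
        = ereal (?L d (cond_mean w))" for d
      using ext_excess_true_loss[of "\<kappa> w" d] prob_space_kernel[of w] measurable_kernel[OF _ meas_c] that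
      by (auto simp: cond_mean_def)
    moreover have "ext_expectation (\<kappa> w) (l d) - (INF d'. ext_expectation (\<kappa> w) (l d'))
        = ereal (cond_risk w d - min_cond_risk w)" for d
      unfolding inf_l[OF w] by (simp add: ext_l[OF w] cond_risk_def)
    ultimately show ?thesis
      using assms(11)[unfolded calibrated_def, rule_format, OF w \<open>\<epsilon> > 0\<close>] by simp
  qed
  \<comment> \<open>Since regrets are nonnegative, the expected Jensen gap bounds every true risk
    from below. This inequality suffices; attainment of the optimum does not have to be
    shown.\<close>
  have opt_L: "ereal (\<integral>w. opt_value (cond_mean w) - (\<integral>c. opt_value c \<partial>\<kappa> w) \<partial>\<mu>)
      \<le> optimal_risk (evaluable_rules W xstar) P ?L"
    unfolding optimal_risk_def
  proof (rule INF_greatest)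
    fix g assume "g \<in> evaluable_rules W xstar"
    then have "(\<lambda>w. xstar (g w)) \<in> borel_measurable ?M" by (simp add: evaluable_rules_def)
    then show "ereal (\<integral>w. opt_value (cond_mean w) - (\<integral>c. opt_value c \<partial>\<kappa> w) \<partial>\<mu>) \<le> risk P ?L g"
      by (simp add: risk_true_loss true_loss_nonneg)
  qed
  show ?thesis
  proof (intro allI impI, rule ccontr)
    fix \<epsilon> :: real assume \<epsilon>: "\<epsilon> > 0"
    assume no_\<delta>: "\<not> (\<exists>\<delta>>0. \<forall>g \<in> evaluable_rules W xstar. \<bar>risk P l g\<bar> \<noteq> \<infinity> \<longrightarrow>
      risk P l g \<le> optimal_risk (decision_rules W) P l + ereal \<delta> \<longrightarrow>
      risk P ?L g \<le> optimal_risk (evaluable_rules W xstar) P ?L + ereal \<epsilon>)"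
    \<comment> \<open>The powers of 1/2 are chosen to be summable, so that no subsequence has to be
      extracted later.\<close>
    have "\<exists>g. g \<in> evaluable_rules W xstar \<and> \<bar>risk P l g\<bar> \<noteq> \<infinity> \<and>
        risk P l g \<le> optimal_risk (decision_rules W) P l + ereal ((1 / 2) ^ n) \<and>
        \<not> risk P ?L g \<le> optimal_risk (evaluable_rules W xstar) P ?L + ereal \<epsilon>" for n
      using no_\<delta>[unfolded not_ex, rule_format, of "(1 / 2) ^ n"]
      by (simp only: Ball_def not_all not_imp de_Morgan_conj zero_less_power
          zero_less_divide_1_iff zero_less_numeral simp_thms)
    then obtain g where g: "\<And>n. g n \<in> evaluable_rules W xstar" "\<And>n. \<bar>risk P l (g n)\<bar> \<noteq> \<infinity>"
      "\<And>n. risk P l (g n) \<le> optimal_risk (decision_rules W) P l + ereal ((1 / 2) ^ n)"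
      "\<And>n. \<not> risk P ?L (g n) \<le> optimal_risk (evaluable_rules W xstar) P ?L + ereal \<epsilon>"
      by metis
    have g_meas: "g n \<in> borel_measurable ?M" and xg_meas: "(\<lambda>w. xstar (g n w)) \<in> borel_measurable ?M" for n
      using g(1)[of n] by (simp_all add: evaluable_rules_def decision_rules_def)
    \<comment> \<open>Finite extended risk means integrable loss, without which surrogate risks
      could not be compared by subtraction.\<close>
    have int_g: "integrable P (\<lambda>(w, c). l (g n w) c)" for n
      using g(2)[of n] by (intro integrable_if_ext_expectation_finite) (simp add: risk_def)
    have "(\<integral>\<^sup>+ w. ennreal (cond_risk w (g n w) - min_cond_risk w) \<partial>\<mu>) \<le> ennreal (2 * (1 / 2) ^ n)" for n
    proof (rule conditional_excess_bound[OF g_meas int_g])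
      fix g' assume g': "g' \<in> borel_measurable ?M" "integrable P (\<lambda>(w, c). l (g' w) c)"
      then have "optimal_risk (decision_rules W) P l \<le> risk P l g'"
        by (auto simp: optimal_risk_def decision_rules_def intro: INF_lower)
      then have "risk P l (g n) \<le> risk P l g' + ereal ((1 / 2) ^ n)"
        using g(3)[of n] by (meson add_right_mono order_trans)
      then show "(\<integral>(w, c). l (g n w) c \<partial>P) \<le> (\<integral>(w, c). l (g' w) c \<partial>P) + (1 / 2) ^ n"
        using int_g[of n] g'(2) by (simp add: risk_def ext_expectation_eq_integral)
    qed simp
    then have ae: "AE w in \<mu>. (\<lambda>n. cond_risk w (g n w) - min_cond_risk w) \<longlonglongrightarrow> 0"
      by (rule AE_cond_excess_tendsto_0[OF g_meas])
    have "AE w in \<mu>. (\<lambda>n. ?L (g n w) (cond_mean w)) \<longlonglongrightarrow> 0"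
      using ae AE_integrable_kernel_id AE_space
    proof eventually_elim
      case (elim w)
      then have w: "w \<in> W" by simp
      show ?case
      proof (rule tendstoI)
        fix e :: real assume "e > 0"
        then obtain \<delta> where "\<delta> > 0"
          and \<delta>: "\<And>d. cond_risk w d - min_cond_risk w < \<delta> \<Longrightarrow> ?L d (cond_mean w) < e"
          using calib[OF w elim(2)] by blast
        have "\<forall>\<^sub>F n in sequentially. cond_risk w (g n w) - min_cond_risk w < \<delta>"
          by (rule order_tendstoD(2)[OF elim(1) \<open>\<delta> > 0\<close>])
        then show "\<forall>\<^sub>F n in sequentially. dist (?L (g n w) (cond_mean w)) 0 < e"
          by eventually_elim (simp add: \<delta> true_loss_nonneg)
      qed
    qed
    then have "(\<lambda>n. \<integral>w. ?L (g n w) (cond_mean w) \<partial>\<mu>) \<longlonglongrightarrow> (\<integral>w. 0 \<partial>\<mu>)"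
    proof (rule integral_dominated_convergence[rotated 3])
      show "integrable \<mu> (\<lambda>w. 2 * (bnd + bnd * norm (cond_mean w)))"
        by (rule integrable_mult_right[OF integrable_cond_mean_bound])
      show "(\<lambda>w. ?L (g n w) (cond_mean w)) \<in> borel_measurable \<mu>" for n
        using measurable_true_loss_cond_mean[OF xg_meas] by simp
      show "AE w in \<mu>. norm (?L (g n w) (cond_mean w)) \<le> 2 * (bnd + bnd * norm (cond_mean w))" for n
        unfolding real_norm_def by (intro AE_I2 abs_true_loss_le)
    qed simp
    then have "\<forall>\<^sub>F n in sequentially. (\<integral>w. ?L (g n w) (cond_mean w) \<partial>\<mu>) < \<epsilon>"
      using \<epsilon> by (intro order_tendstoD(2)) auto
    then obtain n where n: "(\<integral>w. ?L (g n w) (cond_mean w) \<partial>\<mu>) < \<epsilon>"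
      by (auto simp: eventually_sequentially)
    \<comment> \<open>One rule of the sequence with expected regret below \<epsilon> already
      contradicts its choice.\<close>
    have "risk P ?L (g n) \<le> ereal \<epsilon> +
        ereal (\<integral>w. opt_value (cond_mean w) - (\<integral>c. opt_value c \<partial>\<kappa> w) \<partial>\<mu>)"
      using n by (simp add: risk_true_loss[OF xg_meas])
    also have "\<dots> \<le> ereal \<epsilon> + optimal_risk (evaluable_rules W xstar) P ?L"
      by (rule add_left_mono[OF opt_L])
    finally show False using g(4)[of n] by (simp add: add.commute)
  qed
qed

end
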